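(* For every $m\geq2$, there are no proper biharmonic quadratic forms from $\mathbb{S}^m$ to $\mathbb{S}^2$.
   Context: $\mathbb{S}^m$ is the unit sphere in $\mathbb{R}^{m+1}$ with its round metric. A quadratic form from $\mathbb{S}^m$ to $\mathbb{S}^n$ is a non-constant map $\phi:\mathbb{S}^m\to\mathbb{S}^n$ which is the restriction of a map $F:\mathbb{R}^{m+1}\to\mathbb{R}^{n+1}$ all of whose components are homogeneous polynomials of degree $2$ and with $F(\mathbb{S}^m)\subset\mathbb{S}^n$. For a smooth map $\phi:(M,g)\to(N,h)$ between Riemannian manifolds, the tension field is $\tau(\phi)=\operatorname{trace}\nabla d\phi$ and the bitension field is $\tau_2(\phi)=-\Delta\tau(\phi)-\operatorname{trace}R^N(d\phi(\cdot),\tau(\phi))d\phi(\cdot)$, where $\Delta\sigma=-\operatorname{trace}_g\nabla^2\sigma$ is the rough Laplacian on sections of $\phi^{-1}TN$ and $R(X,Y)Z=\nabla_X\nabla_YZ-\nabla_Y\nabla_XZ-\nabla_{[X,Y]}Z$. The map $\phi$ is harmonic if $\tau(\phi)=0$, biharmonic if $\tau_2(\phi)=0$, and proper biharmonic if it is biharmonic and not harmonic. *)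

theory Defs
  imports "HOL-Analysis.Analysis"
begin

text \<open>
  The unit sphere of a Euclidean space is \<^term>\<open>sphere 0 1\<close>, with the metric induced by the
  ambient inner product.  Its tangent space at \<open>x\<close> is \<open>{v. v \<bullet> x = 0}\<close>.  Maps between spheres
  and vector fields on (or along maps between) spheres are total functions of which only the
  values on the sphere are relevant.  A quadratic form between spheres is automatically smooth, so
  that all derivatives below exist.
\<close>

definition sphere_tangent :: "'a::euclidean_space \<Rightarrow> 'a set" where
  "sphere_tangent x = {v. v \<bullet> x = 0}"

text \<open>Orthogonal projection onto the tangent space at a unit vector \<open>x\<close>.\<close>

definition tangent_proj :: "'a::euclidean_space \<Rightarrow> 'a \<Rightarrow> 'a" where
  "tangent_proj x v = v - (v \<bullet> x) *\<^sub>R x"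

text \<open>
  Differential at \<open>x\<close> of a map defined on the sphere, applied to a tangent vector \<open>v\<close>.  The map
  is first extended to be constant along rays; lemma \<open>sphere_diff_eq\<close> shows that for tangent
  vectors this is the usual differential of a map on a submanifold.
\<close>

definition sphere_diff ::
    "('a::euclidean_space \<Rightarrow> 'b::euclidean_space) \<Rightarrow> 'a \<Rightarrow> 'a \<Rightarrow> 'b" where
  "sphere_diff f x v = frechet_derivative (\<lambda>y. f (y /\<^sub>R norm y)) (at x) v"

text \<open>
  \<open>levi_civita Y x v\<close> is \<open>\<nabla>\<^sub>v Y\<close> at \<open>x\<close>, for a tangent vector field \<open>Y\<close> on the sphere: the
  Levi-Civita connection of a submanifold of Euclidean space is the tangential part of the flat
  derivative (see \<open>levi_civita_metric\<close> and \<open>levi_civita_torsion_free\<close>).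
\<close>

definition levi_civita :: "('a::euclidean_space \<Rightarrow> 'a) \<Rightarrow> 'a \<Rightarrow> 'a \<Rightarrow> 'a" where
  "levi_civita Y x v = tangent_proj x (sphere_diff Y x v)"

definition lie_bracket ::
    "('a::euclidean_space \<Rightarrow> 'a) \<Rightarrow> ('a \<Rightarrow> 'a) \<Rightarrow> 'a \<Rightarrow> 'a" where
  "lie_bracket X Y x = sphere_diff Y x (X x) - sphere_diff X x (Y x)"

text \<open>
  The tangent vector field through which a tangent vector \<open>v\<close> at a point is extended to the whole
  sphere whenever a tensor is defined by a formula involving vector fields.  By tensoriality the
  choice of the extension is immaterial.
\<close>

definition extend_tangent :: "'a::euclidean_space \<Rightarrow> 'a \<Rightarrow> 'a" where
  "extend_tangent v y = tangent_proj y v"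

text \<open>\<open>R(X,Y)Z = \<nabla>\<^sub>X\<nabla>\<^sub>Y Z - \<nabla>\<^sub>Y\<nabla>\<^sub>X Z - \<nabla>\<^bsub>[X,Y]\<^esub> Z\<close> for tangent vector fields.\<close>

definition curvature_field ::
    "('a::euclidean_space \<Rightarrow> 'a) \<Rightarrow> ('a \<Rightarrow> 'a) \<Rightarrow> ('a \<Rightarrow> 'a) \<Rightarrow> 'a \<Rightarrow> 'a" where
  "curvature_field X Y Z x =
     levi_civita (\<lambda>y. levi_civita Z y (Y y)) x (X x)
   - levi_civita (\<lambda>y. levi_civita Z y (X y)) x (Y x)
   - levi_civita Z x (lie_bracket X Y x)"

definition sphere_curvature :: "'a::euclidean_space \<Rightarrow> 'a \<Rightarrow> 'a \<Rightarrow> 'a \<Rightarrow> 'a" where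
  "sphere_curvature x u v w =
     curvature_field (extend_tangent u) (extend_tangent v) (extend_tangent w) x"

text \<open>
  The connection of the pull-back of the tangent bundle of the target sphere under \<open>\<phi>\<close>, where
  \<open>\<sigma>\<close> is a section, i.e. \<open>\<sigma> y\<close> is tangent to the target sphere at \<open>\<phi> y\<close>.
\<close>

definition pullback_conn ::
    "('a::euclidean_space \<Rightarrow> 'b::euclidean_space) \<Rightarrow> ('a \<Rightarrow> 'b) \<Rightarrow> 'a \<Rightarrow> 'a \<Rightarrow> 'b" where
  "pullback_conn \<phi> \<sigma> x v = tangent_proj (\<phi> x) (sphere_diff \<sigma> x v)"

definition orthonormal_tangent_basis :: "'a::euclidean_space \<Rightarrow> 'a set \<Rightarrow> bool" where
  "orthonormal_tangent_basis x B \<longleftrightarrow>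
     pairwise orthogonal B \<and> (\<forall>e\<in>B. norm e = 1) \<and> span B = sphere_tangent x"

text \<open>Trace of a bilinear form on the tangent space at \<open>x\<close>, independent of the basis chosen.\<close>

definition tangent_trace ::
    "'a::euclidean_space \<Rightarrow> ('a \<Rightarrow> 'a \<Rightarrow> 'b::euclidean_space) \<Rightarrow> 'b" where
  "tangent_trace x b = (\<Sum>e \<in> (SOME B. orthonormal_tangent_basis x B). b e e)"

text \<open>\<open>(\<nabla>d\<phi>)(u,v) = \<nabla>\<^sup>\<phi>\<^sub>u (d\<phi>(V)) - d\<phi>(\<nabla>\<^sub>u V)\<close>, where \<open>V\<close> extends \<open>v\<close>.\<close>

definition nabla_diff ::
    "('a::euclidean_space \<Rightarrow> 'b::euclidean_space) \<Rightarrow> 'a \<Rightarrow> 'a \<Rightarrow> 'a \<Rightarrow> 'b" where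
  "nabla_diff \<phi> x u v =
     pullback_conn \<phi> (\<lambda>y. sphere_diff \<phi> y (extend_tangent v y)) x u
   - sphere_diff \<phi> x (levi_civita (extend_tangent v) x u)"

definition tension_field ::
    "('a::euclidean_space \<Rightarrow> 'b::euclidean_space) \<Rightarrow> 'a \<Rightarrow> 'b" where
  "tension_field \<phi> x = tangent_trace x (nabla_diff \<phi> x)"

text \<open>\<open>(\<nabla>\<^sup>2\<sigma>)(u,v) = \<nabla>\<^sup>\<phi>\<^sub>u \<nabla>\<^sup>\<phi>\<^sub>V \<sigma> - \<nabla>\<^sup>\<phi>\<^sub>W \<sigma>\<close>, where \<open>V\<close> extends \<open>v\<close> and \<open>W = \<nabla>\<^sub>u V\<close>.\<close>

definition nabla2 ::
    "('a::euclidean_space \<Rightarrow> 'b::euclidean_space) \<Rightarrow> ('a \<Rightarrow> 'b) \<Rightarrow> 'a \<Rightarrow> 'a \<Rightarrow> 'a \<Rightarrow> 'b" where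
  "nabla2 \<phi> \<sigma> x u v =
     pullback_conn \<phi> (\<lambda>y. pullback_conn \<phi> \<sigma> y (extend_tangent v y)) x u
   - pullback_conn \<phi> \<sigma> x (levi_civita (extend_tangent v) x u)"

definition rough_laplacian ::
    "('a::euclidean_space \<Rightarrow> 'b::euclidean_space) \<Rightarrow> ('a \<Rightarrow> 'b) \<Rightarrow> 'a \<Rightarrow> 'b" where
  "rough_laplacian \<phi> \<sigma> x = - tangent_trace x (nabla2 \<phi> \<sigma> x)"

definition bitension_field ::
    "('a::euclidean_space \<Rightarrow> 'b::euclidean_space) \<Rightarrow> 'a \<Rightarrow> 'b" where
  "bitension_field \<phi> x =
     - rough_laplacian \<phi> (tension_field \<phi>) x
     - tangent_trace x (\<lambda>u v. sphere_curvature (\<phi> x)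
         (sphere_diff \<phi> x u) (tension_field \<phi> x) (sphere_diff \<phi> x v))"

definition harmonic_sphere_map :: "('a::euclidean_space \<Rightarrow> 'b::euclidean_space) \<Rightarrow> bool" where
  "harmonic_sphere_map \<phi> \<longleftrightarrow> (\<forall>x \<in> sphere 0 1. tension_field \<phi> x = 0)"

definition biharmonic_sphere_map :: "('a::euclidean_space \<Rightarrow> 'b::euclidean_space) \<Rightarrow> bool" where
  "biharmonic_sphere_map \<phi> \<longleftrightarrow> (\<forall>x \<in> sphere 0 1. bitension_field \<phi> x = 0)"

definition proper_biharmonic_sphere_map ::
    "('a::euclidean_space \<Rightarrow> 'b::euclidean_space) \<Rightarrow> bool" where
  "proper_biharmonic_sphere_map \<phi> \<longleftrightarrow> biharmonic_sphere_map \<phi> \<and> \<not> harmonic_sphere_map \<phi>"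

definition homogeneous_quadratic :: "(real ^ 'k \<Rightarrow> real) \<Rightarrow> bool" where
  "homogeneous_quadratic p \<longleftrightarrow>
     (\<exists>a :: 'k \<Rightarrow> 'k \<Rightarrow> real. \<forall>x. p x = (\<Sum>i\<in>UNIV. \<Sum>j\<in>UNIV. a i j * x $ i * x $ j))"

definition sphere_quadratic_form :: "(real ^ 'k \<Rightarrow> real ^ 'l) \<Rightarrow> bool" where
  "sphere_quadratic_form \<phi> \<longleftrightarrow>
     \<not> \<phi> constant_on sphere 0 1 \<and>
     (\<exists>F :: real ^ 'k \<Rightarrow> real ^ 'l.
        (\<forall>i. homogeneous_quadratic (\<lambda>x. F x $ i)) \<and>
        F ` sphere 0 1 \<subseteq> sphere 0 1 \<and>
        (\<forall>x \<in> sphere 0 1. \<phi> x = F x))"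


text \<open>Consistency of the extrinsic definitions with the intrinsic notions.\<close>

lemma normalize_has_derivative:
  fixes x :: "'a::euclidean_space"
  assumes "norm x = 1"
  shows "((\<lambda>y. y /\<^sub>R norm y) has_derivative tangent_proj x) (at x)"
proof -
  have "x \<noteq> 0" using assms by auto
  then have n: "(norm has_derivative (\<lambda>v. v \<bullet> x)) (at x)"
    using has_derivative_norm[of x] by (simp add: assms sgn_div_norm inner_commute)
  show ?thesis
    using \<open>x \<noteq> 0\<close> by (auto intro!: derivative_eq_intros n simp: assms tangent_proj_def sgn_div_norm fun_eq_iff
        inner_commute algebra_simps)
qed

lemma sphere_diff_has_derivative:
  fixes f :: "'a::euclidean_space \<Rightarrow> 'b::euclidean_space"
  assumes "(f has_derivative f') (at x within sphere 0 1)" "norm x = 1"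
  shows "((\<lambda>y. f (y /\<^sub>R norm y)) has_derivative (\<lambda>v. f' (tangent_proj x v))) (at x)"
proof -
  have o: "open (- {0::'a})" and x: "x \<in> - {0::'a}"
    using assms(2) by auto
  have "((\<lambda>y. y /\<^sub>R norm y) has_derivative tangent_proj x) (at x within - {0})"
    using normalize_has_derivative[OF assms(2)] has_derivative_at_withinI by blast
  moreover have "(f has_derivative f') (at (x /\<^sub>R norm x) within (\<lambda>y. y /\<^sub>R norm y) ` (- {0}))"
    by (rule has_derivative_subset[where s = "sphere 0 1"]) (use assms in \<open>auto simp: field_simps split: if_splits\<close>)
  ultimately have "((f \<circ> (\<lambda>y. y /\<^sub>R norm y)) has_derivative (f' \<circ> tangent_proj x))
      (at x within - {0})"
    by (rule diff_chain_within)
  then show ?thesis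
    using at_within_open[OF x o] by (simp add: o_def)
qed

lemma sphere_diff_eq:
  fixes f :: "'a::euclidean_space \<Rightarrow> 'b::euclidean_space"
  assumes "(f has_derivative f') (at x within sphere 0 1)" "norm x = 1" "v \<in> sphere_tangent x"
  shows "sphere_diff f x v = f' v"
proof -
  have "sphere_diff f x v = f' (tangent_proj x v)"
    unfolding sphere_diff_def
    using frechet_derivative_at[OF sphere_diff_has_derivative[OF assms(1,2)]] by metis
  then show ?thesis
    using assms(3) by (simp add: tangent_proj_def sphere_tangent_def)
qed

lemma levi_civita_metric:
  fixes Y Z :: "'a::euclidean_space \<Rightarrow> 'a"
  assumes "Y differentiable at x within sphere 0 1" "Z differentiable at x within sphere 0 1"
    and "norm x = 1" "v \<in> sphere_tangent x" "Y x \<in> sphere_tangent x" "Z x \<in> sphere_tangent x"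
  shows "sphere_diff (\<lambda>y. Y y \<bullet> Z y) x v = levi_civita Y x v \<bullet> Z x + Y x \<bullet> levi_civita Z x v"
proof -
  obtain Y' Z' where d: "(Y has_derivative Y') (at x within sphere 0 1)"
      "(Z has_derivative Z') (at x within sphere 0 1)"
    using assms(1,2) unfolding differentiable_def by blast
  have "((\<lambda>y. Y y \<bullet> Z y) has_derivative (\<lambda>v. Y x \<bullet> Z' v + Y' v \<bullet> Z x)) (at x within sphere 0 1)"
    using d by (rule has_derivative_inner)
  then show ?thesis
    using assms(3-) d
    by (simp add: sphere_diff_eq levi_civita_def tangent_proj_def sphere_tangent_def
        inner_diff_left inner_diff_right inner_commute)
qed

lemma levi_civita_torsion_free:
  fixes X Y :: "'a::euclidean_space \<Rightarrow> 'a"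
  assumes "X differentiable at x within sphere 0 1" "Y differentiable at x within sphere 0 1"
    and tan: "\<And>y. norm y = 1 \<Longrightarrow> X y \<in> sphere_tangent y" "\<And>y. norm y = 1 \<Longrightarrow> Y y \<in> sphere_tangent y"
    and x: "norm x = 1"
  shows "levi_civita Y x (X x) - levi_civita X x (Y x) = lie_bracket X Y x"
proof -
  have key: "sphere_diff Z x v \<bullet> x = - (Z x \<bullet> v)"
    if Z: "Z differentiable at x within sphere 0 1" "\<And>y. norm y = 1 \<Longrightarrow> Z y \<in> sphere_tangent y"
      and v: "v \<in> sphere_tangent x" for Z v
  proof -
    obtain Z' where d: "(Z has_derivative Z') (at x within sphere 0 1)"
      using Z(1) unfolding differentiable_def by blast
    have "((\<lambda>y. Z y \<bullet> y) has_derivative (\<lambda>v. Z x \<bullet> v + Z' v \<bullet> x)) (at x within sphere 0 1)"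
      by (rule has_derivative_inner[OF d has_derivative_ident])
    moreover have "((\<lambda>y. Z y \<bullet> y) has_derivative (\<lambda>v. 0)) (at x within sphere 0 1)"
      by (rule has_derivative_transform[OF _ _ has_derivative_const[of 0]])
        (use Z(2) x in \<open>auto simp: sphere_tangent_def\<close>)
    ultimately have "Z x \<bullet> v + Z' v \<bullet> x = 0"
      using sphere_diff_eq[OF _ x v] by metis
    then show ?thesis
      using sphere_diff_eq[OF d x v] by simp
  qed
  have "lie_bracket X Y x \<bullet> x = 0"
    unfolding lie_bracket_def inner_diff_left
    using key[OF assms(2) tan(2) tan(1)[OF x]] key[OF assms(1) tan(1) tan(2)[OF x]]
    by (simp add: inner_commute)
  then show ?thesis
    by (simp add: levi_civita_def tangent_proj_def lie_bracket_def inner_diff_left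
        algebra_simps)
qed

end

theory Submission
  imports Defs "HOL-Analysis.Cross3"
begin

text \<open>
Let \<open>F\<close> be the homogeneous quadratic map with \<open>\<phi> = F\<close> on the sphere, \<open>B\<close> its polar form, so that
\<open>F x = B x x\<close>, and \<open>n\<close> the dimension of the domain space. Three ideas carry the proof.

First, the Euclidean Laplacian of \<open>F\<close> is a constant vector \<open>a\<close>, and since \<open>F\<close> restricted to the
sphere has length one, the tension field at \<open>x\<close> is the component of \<open>a\<close> tangent to the target
sphere at \<open>F x\<close>, namely \<open>\<tau> = a - h(x) F x\<close> with \<open>h(x) = a \<bullet> F x\<close> (\<open>tension_field_eq\<close>). Thus
\<open>\<tau>\<close> is the composition with \<open>\<phi>\<close> of a conformal gradient field of the target, and the bitension
field can be computed in closed form. Its inner product with \<open>a\<close> shows that a biharmonic \<open>\<phi>\<close>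
satisfies \<open>|grad h|\<^sup>2 = (n - h) (|a|\<^sup>2 - h\<^sup>2)\<close> on the unit sphere (\<open>biharmonic_identity\<close>).

Secondly, this identity forces \<open>h\<close> to be constant on the sphere (\<open>biharmonic_height_constant\<close>).
Join a maximum point of \<open>h\<close> to a minimum point by the great circle \<open>\<surd>t x1 + \<surd>(1 - t) x2\<close>.
Both points are eigenvectors of the quadratic form \<open>h\<close>, so along the circle \<open>h\<close> is affine in \<open>t\<close>
and the squared gradient is quadratic in \<open>t\<close>, whereas the other side is a cubic in \<open>h\<close>. If
\<open>h = l\<close> is constant, the identity reads \<open>(n - l) (|a|\<^sup>2 - l\<^sup>2) = 0\<close>. If \<open>l\<^sup>2 = |a|\<^sup>2\<close>, then
\<open>\<tau>\<close> vanishes and \<open>\<phi>\<close> is harmonic.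

Thirdly, the remaining case \<open>l = n\<close>, in which \<open>\<phi>\<close> maps into the small circle of the two-sphere of
radius \<open>1/\<surd>2\<close>, needs \<open>n \<le> 2\<close> (\<open>constant_height_dim_le_2\<close>). For a fixed unit vector \<open>x\<close>, the
vectors \<open>B x y\<close> with \<open>y\<close> orthogonal to \<open>x\<close> are tangent to that circle, hence all parallel, and
\<open>|B x y|\<^sup>2 = (w \<bullet> y)\<^sup>2\<close> for a single vector \<open>w\<close>. Taking traces in the polarised equation
\<open>|F x|\<^sup>2 = |x|\<^sup>4\<close> gives \<open>|w|\<^sup>2 = n/4\<close>: the whole energy density is concentrated in one direction.
In that direction the equation gives \<open>F x \<bullet> F y = 1 - n/2\<close> for the unit vector \<open>y\<close>, while
two points on the circle have nonnegative inner product.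
\<close>

section \<open>Traces and connections on the sphere\<close>

lemma tangent_basis:
  fixes x :: "'a::euclidean_space"
  defines "E \<equiv> SOME B. orthonormal_tangent_basis x B"
  shows tangent_basis_orthonormal: "orthonormal_tangent_basis x E"
    and tangent_basis_finite: "finite E"
    and tangent_basis_tangent: "\<And>e. e \<in> E \<Longrightarrow> e \<bullet> x = 0"
    and tangent_basis_unit: "\<And>e. e \<in> E \<Longrightarrow> e \<bullet> e = 1"
proof -
  have s: "subspace (sphere_tangent x)"
    unfolding sphere_tangent_def by (auto simp: subspace_def inner_left_distrib)
  obtain B where "orthonormal_tangent_basis x B"
    using orthonormal_basis_subspace[OF s] unfolding orthonormal_tangent_basis_def by metis
  then show E: "orthonormal_tangent_basis x E"
    unfolding E_def by (metis someI)
  then have "0 \<notin> E" unfolding orthonormal_tangent_basis_def by fastforce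
  then show "finite E"
    using E pairwise_orthogonal_independent independent_imp_finite
    unfolding orthonormal_tangent_basis_def by blast
  show "e \<bullet> x = 0" if "e \<in> E" for e
    using E that span_base unfolding orthonormal_tangent_basis_def sphere_tangent_def by blast
  show "e \<bullet> e = 1" if "e \<in> E" for e
    using E that by (simp add: orthonormal_tangent_basis_def dot_square_norm)
qed

lemma orthonormal_expansion:
  fixes C :: "'a::euclidean_space set"
  assumes "finite C" "pairwise orthogonal C" "\<And>e. e \<in> C \<Longrightarrow> e \<bullet> e = 1" "z \<in> span C"
  shows "z = (\<Sum>e\<in>C. (z \<bullet> e) *\<^sub>R e)"
proof -
  obtain u where z: "z = (\<Sum>e\<in>C. u e *\<^sub>R e)"
    using assms(4) unfolding span_finite[OF assms(1)] by blast
  have "z \<bullet> e = u e" if e: "e \<in> C" for e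
  proof -
    have "z \<bullet> e = (\<Sum>d\<in>C. if d = e then u e else 0)"
      unfolding z inner_sum_left
      by (rule sum.cong) (use assms(2,3) e in \<open>auto simp: pairwise_def orthogonal_def\<close>)
    then show ?thesis using assms(1) e by simp
  qed
  then have "(\<Sum>e\<in>C. (z \<bullet> e) *\<^sub>R e) = (\<Sum>e\<in>C. u e *\<^sub>R e)"
    by simp
  with z show ?thesis by (rule trans[OF _ sym])
qed

text \<open>
Adjoining the unit normal \<open>x\<close> to an orthonormal tangent basis gives an orthonormal basis of the
whole space, and the trace of a bilinear form depends on no such choice. Tangential traces thus
become sums over the standard basis.
\<close>

lemma tangent_trace_eq:
  fixes x :: "'a::euclidean_space" and b :: "'a \<Rightarrow> 'a \<Rightarrow> 'b::euclidean_space"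
  assumes "bounded_bilinear b" "norm x = 1"
  shows "tangent_trace x b = (\<Sum>e\<in>Basis. b e e) - b x x"
proof -
  interpret b: bounded_bilinear b by fact
  define E where "E = (SOME B. orthonormal_tangent_basis x B)"
  note E = tangent_basis[where x = x, folded E_def]
  define C where "C = insert x E"
  have xx: "x \<bullet> x = 1" using assms(2) by (simp add: dot_square_norm)
  have xE: "x \<notin> E" using E(3)[of x] xx by auto
  have C: "finite C" "pairwise orthogonal C" "\<And>e. e \<in> C \<Longrightarrow> e \<bullet> e = 1"
    using E xx unfolding C_def orthonormal_tangent_basis_def pairwise_insert
    by (auto simp: orthogonal_def inner_commute)
  have "z \<in> span C" for z
  proof -
    have "z - (z \<bullet> x) *\<^sub>R x \<in> span E"
      using E(1) xx unfolding orthonormal_tangent_basis_def sphere_tangent_def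
      by (simp add: inner_diff_left)
    then have "z - (z \<bullet> x) *\<^sub>R x \<in> span C"
      using span_mono[of E C] unfolding C_def by blast
    moreover have "(z \<bullet> x) *\<^sub>R x \<in> span C"
      by (simp add: C_def span_base span_scale)
    ultimately have "z - (z \<bullet> x) *\<^sub>R x + (z \<bullet> x) *\<^sub>R x \<in> span C"
      by (rule span_add)
    then show ?thesis by simp
  qed
  note ex = orthonormal_expansion[OF C this]
  have "(\<Sum>d\<in>Basis. b d d) = (\<Sum>d\<in>Basis. \<Sum>e\<in>C. (d \<bullet> e) *\<^sub>R b d e)"
  proof (rule sum.cong[OF refl])
    fix d :: 'a
    have "b d d = b d (\<Sum>e\<in>C. (d \<bullet> e) *\<^sub>R e)"
      by (rule arg_cong[OF ex])
    then show "b d d = (\<Sum>e\<in>C. (d \<bullet> e) *\<^sub>R b d e)"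
      by (simp add: b.sum_right b.scaleR_right)
  qed
  also have "\<dots> = (\<Sum>e\<in>C. b (\<Sum>d\<in>Basis. (e \<bullet> d) *\<^sub>R d) e)"
    by (subst sum.swap) (simp add: b.sum_left b.scaleR_left inner_commute)
  also have "\<dots> = (\<Sum>e\<in>C. b e e)"
    by (simp add: euclidean_representation)
  also have "\<dots> = b x x + (\<Sum>e\<in>E. b e e)"
    using E(2) xE by (simp add: C_def)
  finally show ?thesis
    by (simp add: tangent_trace_def E_def)
qed

lemma tangent_trace_cong:
  assumes "\<And>e. e \<bullet> x = 0 \<Longrightarrow> b e e = c e e"
  shows "tangent_trace x b = tangent_trace x c"
  unfolding tangent_trace_def by (rule sum.cong[OF refl]) (use assms tangent_basis(3) in blast)

text \<open>
Fields on the sphere are often given by a formula that is valid at unit vectors only; they may be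
differentiated in tangential directions through any extension of that formula.
\<close>

lemma sphere_diff_eqI:
  fixes f g :: "'a::euclidean_space \<Rightarrow> 'b::euclidean_space"
  assumes "(g has_derivative g') (at x within sphere 0 1)"
    and "\<And>y. norm y = 1 \<Longrightarrow> f y = g y" "norm x = 1" "v \<bullet> x = 0"
  shows "sphere_diff f x v = g' v"
proof -
  have "(f has_derivative g') (at x within sphere 0 1)"
    by (rule has_derivative_transform[OF _ _ assms(1)]) (use assms in auto)
  then show ?thesis
    using assms by (simp add: sphere_diff_eq sphere_tangent_def)
qed

lemma has_derivative_extend_tangent:
  "(extend_tangent v has_derivative (\<lambda>u. - (v \<bullet> u) *\<^sub>R x - (v \<bullet> x) *\<^sub>R u)) (at x within S)"
  unfolding extend_tangent_def tangent_proj_def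
  by (auto intro!: derivative_eq_intros simp: algebra_simps)

lemma sphere_diff_extend_tangent:
  assumes "norm x = 1" "u \<bullet> x = 0"
  shows "sphere_diff (extend_tangent v) x u = - (v \<bullet> u) *\<^sub>R x - (v \<bullet> x) *\<^sub>R u"
  by (rule sphere_diff_eqI[OF has_derivative_extend_tangent refl assms])

text \<open>
The field extending \<open>v\<close> is the gradient of the linear function \<open>y \<mapsto> v \<bullet> y\<close>. It is conformal, and its
covariant derivative vanishes at every \<open>x\<close> orthogonal to \<open>v\<close>, so that the correction terms in the
second covariant derivatives below drop out.
\<close>

lemma levi_civita_extend_tangent:
  assumes "norm x = 1" "u \<bullet> x = 0"
  shows "levi_civita (extend_tangent v) x u = - (v \<bullet> x) *\<^sub>R u"
  using assms
  by (simp add: levi_civita_def tangent_proj_def sphere_diff_extend_tangent dot_square_norm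
      inner_diff_left)

lemma extend_tangent_orthogonal: "norm y = 1 \<Longrightarrow> extend_tangent v y \<bullet> y = 0"
  by (simp add: extend_tangent_def tangent_proj_def inner_diff_left dot_square_norm)

lemma extend_tangent_self: "v \<bullet> x = 0 \<Longrightarrow> extend_tangent v x = v"
  by (simp add: extend_tangent_def tangent_proj_def)

lemma tangent_proj_diff: "tangent_proj p (v - w) = tangent_proj p v - tangent_proj p w"
  and tangent_proj_scaleR: "tangent_proj p (c *\<^sub>R v) = c *\<^sub>R tangent_proj p v"
  and tangent_proj_tangent: "v \<bullet> p = 0 \<Longrightarrow> tangent_proj p v = v"
  and tangent_proj_normal: "norm p = 1 \<Longrightarrow> tangent_proj p p = 0"
  by (simp_all add: tangent_proj_def algebra_simps inner_diff_left dot_square_norm)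

text \<open>
The round sphere has constant sectional curvature one.
\<close>

lemma sphere_curvature_eq:
  fixes p :: "'a::euclidean_space"
  assumes p: "norm p = 1" and t: "u \<bullet> p = 0" "v \<bullet> p = 0" "w \<bullet> p = 0"
  shows "sphere_curvature p u v w = (v \<bullet> w) *\<^sub>R u - (u \<bullet> w) *\<^sub>R v"
proof -
  have main: "levi_civita (\<lambda>y. levi_civita (extend_tangent w) y (extend_tangent v y)) p u
      = - (u \<bullet> w) *\<^sub>R v" if t: "u \<bullet> p = 0" "v \<bullet> p = 0" for u v
  proof -
    have "((\<lambda>y. - (w \<bullet> y) *\<^sub>R (v - (v \<bullet> y) *\<^sub>R y)) has_derivative
        (\<lambda>u. - (w \<bullet> u) *\<^sub>R (v - (v \<bullet> p) *\<^sub>R p) + (w \<bullet> p) *\<^sub>R ((v \<bullet> u) *\<^sub>R p + (v \<bullet> p) *\<^sub>R u)))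
        (at p within sphere 0 1)"
      by (auto intro!: derivative_eq_intros simp: algebra_simps)
    moreover have "levi_civita (extend_tangent w) y (extend_tangent v y)
        = - (w \<bullet> y) *\<^sub>R (v - (v \<bullet> y) *\<^sub>R y)" if "norm y = 1" for y
      using levi_civita_extend_tangent[OF that extend_tangent_orthogonal[OF that]]
      by (simp add: extend_tangent_def tangent_proj_def)
    ultimately have "sphere_diff (\<lambda>y. levi_civita (extend_tangent w) y (extend_tangent v y)) p u
        = - (w \<bullet> u) *\<^sub>R (v - (v \<bullet> p) *\<^sub>R p)
          + (w \<bullet> p) *\<^sub>R ((v \<bullet> u) *\<^sub>R p + (v \<bullet> p) *\<^sub>R u)"
      using p t(1) by (rule sphere_diff_eqI)
    then have "sphere_diff (\<lambda>y. levi_civita (extend_tangent w) y (extend_tangent v y)) p u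
        = - (w \<bullet> u) *\<^sub>R v"
      using t assms(4) by simp
    then show ?thesis
      using t by (simp add: levi_civita_def[of _ p u] tangent_proj_def inner_commute)
  qed
  have "lie_bracket (extend_tangent u) (extend_tangent v) p = 0"
    using assms by (simp add: lie_bracket_def sphere_diff_extend_tangent extend_tangent_self
        inner_commute)
  then show ?thesis
    using assms main[of u v] main[of v u]
    by (simp add: sphere_curvature_def curvature_field_def extend_tangent_self
        levi_civita_extend_tangent)
qed

lemma tangent_trace_linear:
  assumes "linear f"
  shows "tangent_trace x (\<lambda>u v. f (b u v)) = f (tangent_trace x b)"
  unfolding tangent_trace_def using linear_sum[OF assms] by metis

section \<open>Quadratic maps between spheres\<close>

lemma inner_add_scale:
  "(x + t *\<^sub>R y) \<bullet> (x + t *\<^sub>R y) = x \<bullet> x + 2 * t * (x \<bullet> y) + t\<^sup>2 * (y \<bullet> y)" for x y :: "'a::real_inner"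
  by (simp add: inner_left_distrib inner_right_distrib inner_commute power2_eq_square)

text \<open>
Comparison of the coefficients of \<open>t\<close> and \<open>t\<^sup>2\<close> in two polynomials of degree four.
\<close>

lemma quartic_coefficients:
  fixes a b c d e u v w :: real
  assumes "\<And>t. a + t * (4 * b) + t^2 * (2 * c) + t^3 * (4 * d) + t^4 * e
      = (u + 2 * t * v + t^2 * w)^2"
  shows "b = u * v" "c = u * w + 2 * v^2"
proof -
  note 1 = assms[of 0] assms[of 1] assms[of "-1"] assms[of 2] assms[of "-2"]
  show "b = u * v" "c = u * w + 2 * v^2"
    using 1 by (simp_all add: power2_eq_square algebra_simps)
qed

text \<open>
A quadratic form between spheres, given by its polar form \<open>B\<close>. Only the values of \<open>\<phi>\<close> on the sphere
are tied to \<open>B\<close>.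
\<close>

locale quadratic_sphere_map = bounded_bilinear B
  for B :: "'a::euclidean_space \<Rightarrow> 'a \<Rightarrow> 'b::euclidean_space" +
  fixes \<phi> :: "'a \<Rightarrow> 'b"
  assumes commute: "B x y = B y x"
    and norm_diag: "norm (B x x) = (norm x)\<^sup>2"
    and on_sphere: "norm x = 1 \<Longrightarrow> \<phi> x = B x x"
begin

lemma diag_add: "B (x + t *\<^sub>R y) (x + t *\<^sub>R y) = B x x + (2 * t) *\<^sub>R B x y + t\<^sup>2 *\<^sub>R B y y"
proof -
  have "(2 * t) *\<^sub>R B x y = t *\<^sub>R B x y + t *\<^sub>R B x y"
    by (simp only: mult_2 scaleR_add_left)
  then show ?thesis
    by (simp only: add_left add_right scaleR_left scaleR_right scaleR_scaleR power2_eq_square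
        commute[of y x] scaleR_add_right add.assoc)
qed

lemma inner_diag: "B x x \<bullet> B x x = (x \<bullet> x)\<^sup>2"
  using norm_diag[of x] by (simp add: dot_square_norm)

lemma quartic_expansion:
  "B x x \<bullet> B x x + t * (4 * (B x x \<bullet> B x y)) + t^2 * (2 * (B x x \<bullet> B y y + 2 * (B x y \<bullet> B x y)))
    + t^3 * (4 * (B x y \<bullet> B y y)) + t^4 * (B y y \<bullet> B y y)
   = (x \<bullet> x + 2 * t * (x \<bullet> y) + t\<^sup>2 * (y \<bullet> y))\<^sup>2"
proof -
  have "(B x x + (2 * t) *\<^sub>R B x y + t\<^sup>2 *\<^sub>R B y y) \<bullet> (B x x + (2 * t) *\<^sub>R B x y + t\<^sup>2 *\<^sub>R B y y)
      = (x \<bullet> x + 2 * t * (x \<bullet> y) + t\<^sup>2 * (y \<bullet> y))\<^sup>2"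
    using inner_diag[of "x + t *\<^sub>R y"] unfolding diag_add inner_add_scale .
  then show ?thesis
    unfolding inner_left_distrib inner_right_distrib inner_scaleR_left inner_scaleR_right
      inner_commute[of "B y y" "B x x"]
      inner_commute[of "B x y" "B x x"] inner_commute[of "B y y" "B x y"]
    by (simp add: power2_eq_square power3_eq_cube power4_eq_xxxx algebra_simps)
qed

text \<open>
These come from the first and second order terms in \<open>y\<close> of \<open>|F(x + t y)|\<^sup>2 = |x + t y|\<^sup>4\<close>. The first
says that \<open>B x y\<close> is tangent to the target sphere at \<open>F x\<close> when \<open>y\<close> is tangent at \<open>x\<close>.
\<close>

lemma inner_diag_cross: "B x x \<bullet> B x y = (x \<bullet> x) * (x \<bullet> y)"
  and inner_diag_diag:
    "B x x \<bullet> B y y + 2 * (B x y \<bullet> B x y) = (x \<bullet> x) * (y \<bullet> y) + 2 * (x \<bullet> y)\<^sup>2"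
  using quartic_coefficients[OF quartic_expansion[of x _ y]] by auto

lemma norm_eq_1_on_sphere: "norm x = 1 \<Longrightarrow> norm (B x x) = 1"
  by (simp add: norm_diag)

lemma has_derivative_diag: "((\<lambda>y. B y y) has_derivative (\<lambda>u. 2 *\<^sub>R B x u)) (at x within S)"
proof -
  have "B x u + B u x = 2 *\<^sub>R B x u" for u
    unfolding commute[of u x] by (rule scaleR_2[symmetric])
  then show ?thesis
    using FDERIV[OF has_derivative_ident has_derivative_ident, of x S] by simp
qed

lemma has_derivative_bilinear_extend_tangent:
  "((\<lambda>y. B y (v - (v \<bullet> y) *\<^sub>R y)) has_derivative
    (\<lambda>u. B u v - (v \<bullet> u) *\<^sub>R B x x - (2 * (v \<bullet> x)) *\<^sub>R B x u)) (at x within S)"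
proof -
  from FDERIV[OF has_derivative_ident has_derivative_extend_tangent[unfolded extend_tangent_def
      tangent_proj_def]] show ?thesis
  proof (rule has_derivative_eq_rhs, intro ext)
    fix u
    show "B x (- (v \<bullet> u) *\<^sub>R x - (v \<bullet> x) *\<^sub>R u) + B u (v - (v \<bullet> x) *\<^sub>R x)
        = B u v - (v \<bullet> u) *\<^sub>R B x x - (2 * (v \<bullet> x)) *\<^sub>R B x u"
      unfolding diff_right scaleR_right commute[of u x] mult_2 scaleR_add_left
      by simp
  qed
qed

section \<open>Tension and bitension field of a quadratic map\<close>

text \<open>
The Laplacian of \<open>y \<mapsto> B y y\<close> on the Euclidean space, which is a constant vector.
\<close>

definition ambient_laplacian :: 'b
  where "ambient_laplacian = 2 *\<^sub>R (\<Sum>e\<in>Basis. B e e)"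

text \<open>
The polar form of the quadratic function \<open>h(x) = a \<bullet> B x x\<close>, which measures the position of \<open>\<phi> x\<close>
along the axis of \<open>a\<close>, the ambient Laplacian.
\<close>

definition height :: "'a \<Rightarrow> 'a \<Rightarrow> real"
  where "height x y = ambient_laplacian \<bullet> B x y"

lemma sphere_diff_eq_bilinear:
  assumes "norm x = 1" "v \<bullet> x = 0"
  shows "sphere_diff \<phi> x v = 2 *\<^sub>R B x v"
proof -
  note has_derivative_diag[of x "sphere 0 1"]
  from sphere_diff_eqI[OF this, of \<phi> v] show ?thesis
    using assms on_sphere by simp
qed

lemma nabla_diff_eq:
  assumes x: "norm x = 1" and t: "u \<bullet> x = 0" "v \<bullet> x = 0"
  shows "nabla_diff \<phi> x u v = tangent_proj (B x x) (2 *\<^sub>R B u v)"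
proof -
  note has_derivative_scaleR_right[OF has_derivative_bilinear_extend_tangent[of v x "sphere 0 1"], of 2]
  moreover have "sphere_diff \<phi> y (extend_tangent v y) = 2 *\<^sub>R B y (v - (v \<bullet> y) *\<^sub>R y)"
    if "norm y = 1" for y
    using sphere_diff_eq_bilinear[OF that extend_tangent_orthogonal[OF that]]
    by (simp add: extend_tangent_def tangent_proj_def)
  ultimately have "sphere_diff (\<lambda>y. sphere_diff \<phi> y (extend_tangent v y)) x u
      = 2 *\<^sub>R (B u v - (v \<bullet> u) *\<^sub>R B x x - (2 * (v \<bullet> x)) *\<^sub>R B x u)"
    using x t(1) by (rule sphere_diff_eqI)
  then have "sphere_diff (\<lambda>y. sphere_diff \<phi> y (extend_tangent v y)) x u
      = 2 *\<^sub>R (B u v - (v \<bullet> u) *\<^sub>R B x x)"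
    using t by simp
  then show ?thesis
    using x t
    by (simp add: nabla_diff_def pullback_conn_def on_sphere levi_civita_extend_tangent
        sphere_diff_eq_bilinear zero_right norm_eq_1_on_sphere tangent_proj_diff
        tangent_proj_scaleR tangent_proj_normal)
qed

text \<open>
The trace over tangent vectors misses the normal term \<open>2 B x x\<close>, but this term is killed by the
projection.
\<close>

lemma tangent_trace_nabla:
  assumes x: "norm x = 1"
  shows "tangent_trace x (\<lambda>u v. tangent_proj (B x x) (2 *\<^sub>R B u v))
    = tangent_proj (B x x) ambient_laplacian"
proof -
  have "linear (\<lambda>v. tangent_proj (B x x) (2 *\<^sub>R v))"
    unfolding tangent_proj_def by (intro linearI) (simp_all add: algebra_simps inner_left_distrib)
  from tangent_trace_linear[OF this, of x B] show ?thesis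
    using inner_diag[of x] x tangent_trace_eq[OF bounded_bilinear_axioms x]
    by (simp add: ambient_laplacian_def tangent_proj_def dot_square_norm inner_diff_left
        algebra_simps)
qed

lemma tension_field_eq:
  assumes x: "norm x = 1"
  shows "tension_field \<phi> x = ambient_laplacian - height x x *\<^sub>R B x x"
proof -
  have "tension_field \<phi> x = tangent_trace x (\<lambda>u v. tangent_proj (B x x) (2 *\<^sub>R B u v))"
    unfolding tension_field_def by (rule tangent_trace_cong) (use x nabla_diff_eq in simp)
  then show ?thesis
    using tangent_trace_nabla[OF x] by (simp add: tangent_proj_def height_def)
qed

lemma height_simps:
  "height (x + y) z = height x z + height y z"
  "height (c *\<^sub>R x) z = c * height x z" "height z (c *\<^sub>R x) = c * height z x"
  "height 0 z = 0"
  by (simp_all add: height_def add_left scaleR_left scaleR_right zero_left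
      inner_right_distrib)

lemma height_commute: "height x y = height y x"
  by (simp add: height_def commute)

text \<open>
The tension field is the restriction to the image of \<open>\<phi>\<close> of the field \<open>z \<mapsto> a - (a \<bullet> z) z\<close>, whose
covariant derivative in direction \<open>Z\<close> is \<open>- (a \<bullet> z) Z\<close>; here \<open>z = \<phi> x\<close> and \<open>Z = d\<phi>(u) = 2 B x u\<close>.
\<close>

lemma pullback_conn_tension:
  assumes x: "norm x = 1" and t: "u \<bullet> x = 0"
  shows "pullback_conn \<phi> (tension_field \<phi>) x u = - (2 * height x x) *\<^sub>R B x u"
proof -
  have "((\<lambda>y. ambient_laplacian - (ambient_laplacian \<bullet> B y y) *\<^sub>R B y y) has_derivative
      (\<lambda>u. - (2 * height x u) *\<^sub>R B x x - (2 * height x x) *\<^sub>R B x u)) (at x within sphere 0 1)"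
    by (rule has_derivative_eq_rhs[OF has_derivative_diff[OF has_derivative_const
          has_derivative_scaleR[OF has_derivative_inner_right[OF has_derivative_diag]
            has_derivative_diag]]])
      (simp add: height_def fun_eq_iff algebra_simps)
  from sphere_diff_eqI[OF this, of "tension_field \<phi>" u]
  have "sphere_diff (tension_field \<phi>) x u
      = - (2 * height x u) *\<^sub>R B x x - (2 * height x x) *\<^sub>R B x u"
    using x t by (simp add: tension_field_eq height_def)
  moreover have "B x u \<bullet> B x x = 0" "B x x \<bullet> B x x = 1"
    using inner_diag_cross[of x u] inner_diag[of x] x t
    by (simp_all add: inner_commute dot_square_norm)
  ultimately show ?thesis
    using x by (simp add: pullback_conn_def on_sphere tangent_proj_def inner_diff_left)
qed

lemma nabla2_eq:
  assumes x: "norm x = 1" and t: "u \<bullet> x = 0" "v \<bullet> x = 0"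
  shows "nabla2 \<phi> (tension_field \<phi>) x u v
    = - (4 * height x u) *\<^sub>R B x v - height x x *\<^sub>R tangent_proj (B x x) (2 *\<^sub>R B u v)"
proof -
  have "((\<lambda>y. (ambient_laplacian \<bullet> B y y) *\<^sub>R B y (v - (v \<bullet> y) *\<^sub>R y)) has_derivative
      (\<lambda>u. height x x *\<^sub>R (B u v - (v \<bullet> u) *\<^sub>R B x x - (2 * (v \<bullet> x)) *\<^sub>R B x u)
        + (2 * height x u) *\<^sub>R B x (v - (v \<bullet> x) *\<^sub>R x))) (at x within sphere 0 1)"
    by (rule has_derivative_eq_rhs[OF has_derivative_scaleR[OF
          has_derivative_inner_right[OF has_derivative_diag] has_derivative_bilinear_extend_tangent]])
      (simp add: height_def)
  note has_derivative_scaleR_right[OF this, of "-2"]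
  moreover have "pullback_conn \<phi> (tension_field \<phi>) y (extend_tangent v y)
      = (-2) *\<^sub>R ((ambient_laplacian \<bullet> B y y) *\<^sub>R B y (v - (v \<bullet> y) *\<^sub>R y))"
    if "norm y = 1" for y
    using pullback_conn_tension[OF that extend_tangent_orthogonal[OF that]]
    by (simp add: extend_tangent_def tangent_proj_def height_def)
  ultimately have "sphere_diff (\<lambda>y. pullback_conn \<phi> (tension_field \<phi>) y (extend_tangent v y)) x u
      = (-2) *\<^sub>R (height x x *\<^sub>R (B u v - (v \<bullet> u) *\<^sub>R B x x - (2 * (v \<bullet> x)) *\<^sub>R B x u)
        + (2 * height x u) *\<^sub>R B x (v - (v \<bullet> x) *\<^sub>R x))"
    using x t(1) by (rule sphere_diff_eqI)
  then have "sphere_diff (\<lambda>y. pullback_conn \<phi> (tension_field \<phi>) y (extend_tangent v y)) x u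
      = - (4 * height x u) *\<^sub>R B x v - (2 * height x x) *\<^sub>R (B u v - (v \<bullet> u) *\<^sub>R B x x)"
    using t by (simp add: scaleR_add_right)
  moreover have "B x v \<bullet> B x x = 0"
    using inner_diag_cross[of x v] t by (simp add: inner_commute)
  moreover have "pullback_conn \<phi> (tension_field \<phi>) x (levi_civita (extend_tangent v) x u) = 0"
    using x t by (simp add: levi_civita_extend_tangent pullback_conn_tension zero_right)
  ultimately show ?thesis
    using x by (simp add: nabla2_def pullback_conn_def[of _ _ x u] on_sphere norm_eq_1_on_sphere
        tangent_proj_diff tangent_proj_scaleR tangent_proj_normal tangent_proj_tangent mult.commute)
qed

text \<open>
The trace over \<open>y\<close> of \<open>inner_diag_diag\<close>. For unit \<open>x\<close> it expresses the energy density
\<open>|d\<phi>|\<^sup>2 = 2 n - h\<close>, with \<open>n\<close> the dimension of the domain space, in terms of the height; see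
\<open>tangent_trace_cross\<close>.
\<close>

lemma trace_cross: "(\<Sum>e\<in>Basis. B x e \<bullet> B x e)
    = ((DIM('a) + 2) * (x \<bullet> x) - height x x / 2) / 2"
proof -
  have "(\<Sum>e\<in>Basis. B x x \<bullet> B e e + 2 * (B x e \<bullet> B x e))
      = (\<Sum>e\<in>Basis. (x \<bullet> x) + 2 * (x \<bullet> e)\<^sup>2)"
    by (rule sum.cong) (simp_all add: inner_diag_diag)
  also have "\<dots> = (DIM('a) + 2) * (x \<bullet> x)"
    unfolding sum.distrib sum_distrib_left[symmetric] power2_eq_square
      euclidean_inner[of x x, symmetric] by (simp add: algebra_simps)
  also have "(\<Sum>e\<in>Basis. B x x \<bullet> B e e + 2 * (B x e \<bullet> B x e))
      = height x x / 2 + 2 * (\<Sum>e\<in>Basis. B x e \<bullet> B x e)"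
    by (simp add: sum.distrib sum_distrib_left[symmetric] height_def ambient_laplacian_def
        inner_sum_left inner_commute[of "B x x"])
  finally show ?thesis by simp
qed

lemma tangent_trace_height:
  assumes "norm x = 1"
  shows "tangent_trace x (\<lambda>u v. height x u * height x v)
    = (\<Sum>e\<in>Basis. (height x e)\<^sup>2) - (height x x)\<^sup>2"
proof -
  have "bounded_linear (height x)"
    unfolding height_def by (intro bounded_linear_inner_right_comp bounded_linear_right)
  from bounded_bilinear.comp[OF bounded_bilinear_mult this this]
  have "bounded_bilinear (\<lambda>u v. height x u * height x v)" .
  from tangent_trace_eq[OF this assms] show ?thesis
    by (simp add: power2_eq_square)
qed

lemma tangent_trace_cross:
  assumes "norm x = 1"
  shows "4 * tangent_trace x (\<lambda>u v. B x u \<bullet> B x v) = 2 * DIM('a) - height x x"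
proof -
  from bounded_bilinear.comp[OF bounded_bilinear_inner bounded_linear_right bounded_linear_right]
  have "bounded_bilinear (\<lambda>u v. B x u \<bullet> B x v)" .
  from tangent_trace_eq[OF this assms] show ?thesis
    using trace_cross[of x] inner_diag[of x] assms by (simp add: dot_square_norm field_simps)
qed

lemma curvature_term:
  assumes x: "norm x = 1" and t: "u \<bullet> x = 0" "v \<bullet> x = 0"
  shows "sphere_curvature (\<phi> x) (sphere_diff \<phi> x u) (tension_field \<phi> x) (sphere_diff \<phi> x v)
    = (4 * height x v) *\<^sub>R B x u - (4 * (B x u \<bullet> B x v)) *\<^sub>R tension_field \<phi> x"
proof -
  have o: "B x w \<bullet> B x x = 0" if "w \<bullet> x = 0" for w
    using inner_diag_cross[of x w] that by (simp add: inner_commute)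
  have "B x x \<bullet> B x x = 1"
    using inner_diag[of x] x by (simp add: dot_square_norm)
  then show ?thesis
    using x t o[OF t(1)] o[OF t(2)]
    by (subst sphere_curvature_eq)
      (simp_all add: on_sphere norm_eq_1_on_sphere sphere_diff_eq_bilinear tension_field_eq
        inner_diff_left inner_diff_right height_def inner_commute)
qed

text \<open>
The identity \<open>(n - h) |\<tau>|\<^sup>2 = |grad h|\<^sup>2\<close>, obtained by pairing the bitension field with \<open>a\<close>:
the Laplacian and the curvature term both contribute \<open>- |grad h|\<^sup>2\<close>, the Laplacian also
\<open>- h |\<tau>|\<^sup>2\<close> and the curvature term also \<open>|d\<phi>|\<^sup>2 |\<tau>|\<^sup>2\<close>. The right-hand side is \<open>|grad h|\<^sup>2\<close> because
\<open>h\<close> has Euclidean gradient \<open>2 height x\<close>, with normal component \<open>2 h\<close>.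
\<close>

lemma biharmonic_identity:
  assumes x: "norm x = 1" and bi: "bitension_field \<phi> x = 0"
  shows "(real DIM('a) - height x x) * (ambient_laplacian \<bullet> ambient_laplacian - (height x x)\<^sup>2)
    = 4 * ((\<Sum>e\<in>Basis. (height x e)\<^sup>2) - (height x x)\<^sup>2)"
proof -
  let ?a = ambient_laplacian and ?h = "height x x" and ?\<tau> = "tension_field \<phi> x"
  let ?p = "\<lambda>u v. tangent_proj (B x x) (2 *\<^sub>R B u v)"
  have lin: "linear ((\<bullet>) ?a)"
    by (simp add: linear_iff inner_right_distrib)
  have T: "tangent_trace x (\<lambda>u v. ?a \<bullet> ?p u v) = ?a \<bullet> ?\<tau>"
    using tangent_trace_linear[OF lin, of x ?p] tangent_trace_nabla[OF x] tension_field_eq[OF x]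
    by (simp add: tangent_proj_def height_def)
  have "?a \<bullet> tangent_trace x (nabla2 \<phi> (tension_field \<phi>) x)
      = tangent_trace x (\<lambda>u v. -4 * (height x u * height x v) - ?h * (?a \<bullet> ?p u v))"
    unfolding tangent_trace_linear[OF lin, symmetric]
    by (rule tangent_trace_cong) (use x in \<open>simp add: nabla2_eq inner_diff_right height_def\<close>)
  also have "\<dots> = -4 * tangent_trace x (\<lambda>u v. height x u * height x v) - ?h * (?a \<bullet> ?\<tau>)"
    unfolding T[symmetric] by (simp add: tangent_trace_def sum_subtractf sum_distrib_left sum_negf)
  finally have 1: "?a \<bullet> tangent_trace x (nabla2 \<phi> (tension_field \<phi>) x) = \<dots>" .
  have "?a \<bullet> tangent_trace x (\<lambda>u v. sphere_curvature (\<phi> x) (sphere_diff \<phi> x u) ?\<tau>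
        (sphere_diff \<phi> x v))
      = tangent_trace x (\<lambda>u v. 4 * (height x u * height x v) - 4 * ((B x u \<bullet> B x v) * (?a \<bullet> ?\<tau>)))"
    unfolding tangent_trace_linear[OF lin, symmetric]
    by (rule tangent_trace_cong) (use x in \<open>simp add: curvature_term inner_diff_right height_def\<close>)
  also have "\<dots> = 4 * tangent_trace x (\<lambda>u v. height x u * height x v)
      - 4 * tangent_trace x (\<lambda>u v. B x u \<bullet> B x v) * (?a \<bullet> ?\<tau>)"
    by (simp add: tangent_trace_def sum_subtractf sum_distrib_left sum_distrib_right mult.assoc)
  finally have 2: "?a \<bullet> tangent_trace x (\<lambda>u v. sphere_curvature (\<phi> x) (sphere_diff \<phi> x u) ?\<tau>
      (sphere_diff \<phi> x v)) = \<dots>" .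
  have "0 = ?a \<bullet> bitension_field \<phi> x" by (simp add: bi)
  also have "\<dots> = (4 * tangent_trace x (\<lambda>u v. B x u \<bullet> B x v) - ?h) * (?a \<bullet> ?\<tau>)
      - 8 * tangent_trace x (\<lambda>u v. height x u * height x v)"
    unfolding bitension_field_def rough_laplacian_def minus_minus inner_diff_right 1 2
    by (simp add: algebra_simps)
  also have "?a \<bullet> ?\<tau> = ?a \<bullet> ?a - ?h\<^sup>2"
    by (simp add: tension_field_eq[OF x] inner_diff_right height_def power2_eq_square)
  finally show ?thesis
    unfolding tangent_trace_cross[OF x] tangent_trace_height[OF x] by (simp add: algebra_simps)
qed

end

section \<open>The height of a biharmonic quadratic map is constant\<close>

lemma linear_coefficient_zero_if_nonneg:
  fixes R Q :: real
  assumes "\<And>t. 0 \<le> 2 * t * R + t\<^sup>2 * Q"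
  shows "R = 0"
proof (rule ccontr)
  assume R: "R \<noteq> 0"
  define K where "K = \<bar>Q\<bar> + 1"
  have K: "K > 0" "Q < K" by (auto simp: K_def)
  \<comment> \<open>At \<open>t = - R / K\<close> the linear term outweighs the quadratic one.\<close>
  have "0 \<le> (2 * (- R / K) * R + (- R / K)\<^sup>2 * Q) * K\<^sup>2"
    by (rule mult_nonneg_nonneg[OF assms zero_le_power2])
  also have "\<dots> = R\<^sup>2 * (Q - 2 * K)"
    using K(1) by (simp add: field_simps power2_eq_square)
  also have "\<dots> < 0"
    using R K by (intro mult_pos_neg) auto
  finally show False by simp
qed

text \<open>
The left-hand side is a cubic in \<open>k\<close> with leading coefficient \<open>e\<^sup>3\<close>, and the right-hand side is
quadratic in \<open>k\<close>. The third difference over four equidistant points therefore isolates \<open>e\<^sup>3\<close>.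
\<close>

lemma third_difference_rigidity:
  fixes e l n A :: real
  assumes "\<And>k. k \<in> {0, 1, 2, 3} \<Longrightarrow> (n - (l + k * e)) * (A - (l + k * e)\<^sup>2)
      = 4 * (l\<^sup>2 + k * (2 * l * e + 3 * e\<^sup>2) - (l + k * e)\<^sup>2)"
  shows "e = 0"
proof -
  have "(0::real) \<in> {0, 1, 2, 3}" "(1::real) \<in> {0, 1, 2, 3}"
    "(2::real) \<in> {0, 1, 2, 3}" "(3::real) \<in> {0, 1, 2, 3}"
    by simp_all
  from this[THEN assms] have "e ^ 3 = 0"
    by algebra
  then show ?thesis by simp
qed

context quadratic_sphere_map
begin

lemma height_add_scale:
  "height (x + t *\<^sub>R y) (x + t *\<^sub>R y) = height x x + 2 * t * height x y + t\<^sup>2 * height y y"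
  by (simp add: height_def diag_add inner_right_distrib)

text \<open>
The sign \<open>s\<close>, here and in the next lemma, covers maxima (\<open>s = 1\<close>) and minima (\<open>s = -1\<close>) at once.
\<close>

lemma height_homogeneous_bound:
  assumes "\<And>y. norm y = 1 \<Longrightarrow> s * height y y \<le> s * l"
  shows "s * height y y \<le> s * l * (y \<bullet> y)"
proof (cases "y = 0")
  case False
  have "s * height (y /\<^sub>R norm y) (y /\<^sub>R norm y) \<le> s * l"
    using assms False by simp
  then show ?thesis
    using False by (simp add: height_simps dot_square_norm power2_eq_square field_simps)
qed (simp add: height_simps)

text \<open>
The semidefinite form \<open>s (l |y|\<^sup>2 - h(y))\<close> vanishes at \<open>x\<close>, so \<open>x\<close> lies in its kernel. In other words,
points where \<open>h\<close> is extremal on the sphere are eigenvectors.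
\<close>

lemma height_eigenvector:
  assumes "\<And>y. s * height y y \<le> s * l * (y \<bullet> y)" and "height x x = l * (x \<bullet> x)" "s \<noteq> 0"
  shows "height x y = l * (x \<bullet> y)"
proof -
  have "0 \<le> 2 * t * (s * l * (x \<bullet> y) - s * height x y)
      + t\<^sup>2 * (s * l * (y \<bullet> y) - s * height y y)" for t
    using assms(1)[of "x + t *\<^sub>R y"] assms(2)
    unfolding height_add_scale inner_add_scale by (simp add: algebra_simps)
  from linear_coefficient_zero_if_nonneg[OF this] show ?thesis
    using assms(3) by simp
qed

lemma height_extremes:
  obtains x1 l1 x2 l2 where
    "norm x1 = 1" "\<And>y. height y y \<le> l1 * (y \<bullet> y)" "\<And>y. height x1 y = l1 * (x1 \<bullet> y)"
    "norm x2 = 1" "\<And>y. l2 * (y \<bullet> y) \<le> height y y" "\<And>y. height x2 y = l2 * (x2 \<bullet> y)"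
proof -
  have cont: "continuous_on (sphere 0 1) (\<lambda>y. height y y)"
    unfolding height_def by (intro continuous_intros continuous_on)
  have ne: "sphere (0::'a) 1 \<noteq> {}" by simp
  obtain x1 where x1: "norm x1 = 1" "\<And>y. norm y = 1 \<Longrightarrow> height y y \<le> height x1 x1"
    using continuous_attains_sup[OF compact_sphere ne cont] by auto
  obtain x2 where x2: "norm x2 = 1" "\<And>y. norm y = 1 \<Longrightarrow> height x2 x2 \<le> height y y"
    using continuous_attains_inf[OF compact_sphere ne cont] by auto
  note 1 = height_homogeneous_bound[of 1 "height x1 x1"]
  note 2 = height_homogeneous_bound[of "-1" "height x2 x2"]
  show thesis
  proof (rule that[of x1 "height x1 x1" x2 "height x2 x2"])
    show "height x1 y = height x1 x1 * (x1 \<bullet> y)" for y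
      by (rule height_eigenvector[of 1]) (use 1 x1 in \<open>simp_all add: dot_square_norm\<close>)
    show "height x2 y = height x2 x2 * (x2 \<bullet> y)" for y
      by (rule height_eigenvector[of "-1"]) (use 2 x2 in \<open>simp_all add: dot_square_norm\<close>)
  qed (use x1 x2 1 2 in simp_all)
qed

text \<open>
The eigenvectors \<open>x1\<close> and \<open>x2\<close> for the extreme values \<open>l1\<close> and \<open>l2\<close> are orthogonal if \<open>l1\<close> and \<open>l2\<close>
differ. At the unit vector \<open>\<surd>t x1 + \<surd>(1 - t) x2\<close> the height is then \<open>t l1 + (1 - t) l2\<close>, so
\<open>biharmonic_identity\<close> equates a polynomial of degree three in \<open>t\<close> with one of degree at most two.
\<close>

lemma biharmonic_height_constant:
  assumes bi: "\<And>x. norm x = 1 \<Longrightarrow> bitension_field \<phi> x = 0"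
  obtains l where "\<And>x y. height x y = l * (x \<bullet> y)"
    "(real DIM('a) - l) * (ambient_laplacian \<bullet> ambient_laplacian - l\<^sup>2) = 0"
proof -
  obtain x1 l1 x2 l2 where
    x1: "norm x1 = 1" "\<And>y. height y y \<le> l1 * (y \<bullet> y)" "\<And>y. height x1 y = l1 * (x1 \<bullet> y)"
    and x2: "norm x2 = 1" "\<And>y. l2 * (y \<bullet> y) \<le> height y y" "\<And>y. height x2 y = l2 * (x2 \<bullet> y)"
    by (rule height_extremes) (rule that)
  let ?A = "ambient_laplacian \<bullet> ambient_laplacian"
  have eq: "l1 = l2"
  proof (rule ccontr)
    assume ne: "l1 \<noteq> l2"
    have "l1 * (x1 \<bullet> x2) = l2 * (x1 \<bullet> x2)"
      using x1(3)[of x2] x2(3)[of x1] height_commute[of x1 x2] by (auto simp: inner_commute)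
    then have o: "x1 \<bullet> x2 = 0" using ne by simp
    have u: "x1 \<bullet> x1 = 1" "x2 \<bullet> x2 = 1" using x1(1) x2(1) by (simp_all add: dot_square_norm)
    have P: "(real DIM('a) - (t * l1 + (1 - t) * l2)) * (?A - (t * l1 + (1 - t) * l2)\<^sup>2)
        = 4 * (t * l1\<^sup>2 + (1 - t) * l2\<^sup>2 - (t * l1 + (1 - t) * l2)\<^sup>2)" if t: "0 \<le> t" "t \<le> 1" for t
    proof -
      define x where "x = sqrt t *\<^sub>R x1 + sqrt (1 - t) *\<^sub>R x2"
      have sq: "sqrt t * sqrt t = t" "sqrt (1 - t) * sqrt (1 - t) = 1 - t" using t by auto
      have "x \<bullet> x = 1"
        by (simp add: x_def inner_left_distrib inner_right_distrib o inner_commute[of x2 x1] u sq t)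
      then have "norm x = 1" by (simp add: norm_eq_sqrt_inner)
      have h: "height x y = (sqrt t * l1) * (x1 \<bullet> y) + (sqrt (1 - t) * l2) * (x2 \<bullet> y)" for y
        by (simp add: x_def height_simps x1(3) x2(3))
      have hx: "height x x = t * l1 + (1 - t) * l2"
      proof -
        have "x1 \<bullet> x = sqrt t" "x2 \<bullet> x = sqrt (1 - t)"
          by (simp_all add: x_def inner_right_distrib o inner_commute[of x2 x1] u)
        then show ?thesis unfolding h using sq by (simp add: algebra_simps)
      qed
      \<comment> \<open>The vector representing the linear form \<open>height x\<close>.\<close>
      define z where "z = (sqrt t * l1) *\<^sub>R x1 + (sqrt (1 - t) * l2) *\<^sub>R x2"
      have "(\<Sum>e\<in>Basis. (height x e)\<^sup>2) = (\<Sum>e\<in>Basis. (z \<bullet> e) * (z \<bullet> e))"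
        by (simp add: h z_def inner_left_distrib power2_eq_square)
      also have "\<dots> = z \<bullet> z" by (rule euclidean_inner[symmetric])
      also have "\<dots> = (sqrt t * l1) * (sqrt t * l1) + (sqrt (1 - t) * l2) * (sqrt (1 - t) * l2)"
        by (simp add: z_def inner_left_distrib inner_right_distrib o inner_commute[of x2 x1] u)
      also have "\<dots> = (sqrt t * sqrt t) * l1\<^sup>2 + (sqrt (1 - t) * sqrt (1 - t)) * l2\<^sup>2"
        by (simp only: power2_eq_square mult_ac)
      finally show ?thesis
        using biharmonic_identity[OF \<open>norm x = 1\<close> bi[OF \<open>norm x = 1\<close>]] unfolding hx sq by simp
    qed
    \<comment> \<open>The heights at \<open>t = 0, 1/3, 2/3, 1\<close> are \<open>l2 + k e\<close> for \<open>k = 0, 1, 2, 3\<close>.\<close>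
    define e where "e = (l1 - l2) / 3"
    have l1: "l1 = l2 + 3 * e" by (simp add: e_def field_simps)
    have "e = 0"
    proof (rule third_difference_rigidity[of "real DIM('a)" l2 e ?A])
      fix k :: real assume k: "k \<in> {0, 1, 2, 3}"
      have "k / 3 * l1 + (1 - k / 3) * l2 = l2 + k * e"
        "k / 3 * l1\<^sup>2 + (1 - k / 3) * l2\<^sup>2 = l2\<^sup>2 + k * (2 * l2 * e + 3 * e\<^sup>2)"
        by (simp_all add: l1 field_simps power2_eq_square)
      then show "(real DIM('a) - (l2 + k * e)) * (?A - (l2 + k * e)\<^sup>2)
          = 4 * (l2\<^sup>2 + k * (2 * l2 * e + 3 * e\<^sup>2) - (l2 + k * e)\<^sup>2)"
        using P[of "k / 3"] k by auto
    qed
    then show False using ne l1 by simp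
  qed
  have diag: "height y y = l1 * (y \<bullet> y)" for y
    using x1(2)[of y] x2(2)[of y] eq by simp
  have all: "height x y = l1 * (x \<bullet> y)" for x y
    by (rule height_eigenvector[of 1]) (simp_all add: diag)
  have "(\<Sum>e\<in>Basis. (height x1 e)\<^sup>2) = l1\<^sup>2 * (x1 \<bullet> x1)"
    unfolding euclidean_inner[of x1 x1]
    by (simp add: all power2_eq_square sum_distrib_left algebra_simps)
  then have "(real DIM('a) - l1) * (?A - l1\<^sup>2) = 0"
    using biharmonic_identity[OF x1(1) bi[OF x1(1)]] x1(1)
    by (simp add: all dot_square_norm)
  then show thesis using all that by blast
qed

text \<open>
The tension field has squared length \<open>|a|\<^sup>2 - h\<^sup>2\<close>: in this case \<open>\<phi>\<close> maps to a pole of the axis of \<open>a\<close>,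
or \<open>a\<close> is zero.
\<close>

lemma harmonic_if_height_extremal:
  assumes "\<And>x y. height x y = l * (x \<bullet> y)" "ambient_laplacian \<bullet> ambient_laplacian = l\<^sup>2"
  shows "harmonic_sphere_map \<phi>"
  unfolding harmonic_sphere_map_def
proof
  fix x :: 'a assume "x \<in> sphere 0 1"
  then have x: "norm x = 1" by simp
  let ?\<tau> = "ambient_laplacian - height x x *\<^sub>R B x x"
  have "?\<tau> \<bullet> ?\<tau> = ambient_laplacian \<bullet> ambient_laplacian - 2 * height x x * height x x
      + (height x x)\<^sup>2 * (B x x \<bullet> B x x)"
    by (simp add: inner_diff_left inner_diff_right height_def inner_commute power2_eq_square
        algebra_simps)
  also have "\<dots> = 0"
    using assms x inner_diag[of x] by (simp add: dot_square_norm power2_eq_square)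
  finally show "tension_field \<phi> x = 0"
    by (simp add: tension_field_eq[OF x])
qed

end

section \<open>Quadratic maps into a small circle\<close>

text \<open>
The orthogonal complement of two independent vectors in three-space is a line.
\<close>

lemma orthogonal_line_cross3:
  fixes p a z :: "real ^ 3"
  assumes "z \<bullet> p = 0" "z \<bullet> a = 0"
  shows "(cross3 p a \<bullet> cross3 p a) *\<^sub>R z = (cross3 p a \<bullet> z) *\<^sub>R cross3 p a"
proof -
  have "cross3 (cross3 p a) z = 0"
    using assms Lagrange[of z p a] cross_skew[of z "cross3 p a"] by (simp add: inner_commute)
  then show ?thesis
    using Lagrange[of "cross3 p a" "cross3 p a" z] by (simp add: cross_zero_right)
qed

text \<open>
Since the derivative of \<open>\<phi>\<close> has rank at most one, the tangential part of \<open>y \<mapsto> B x y\<close> is described by one vector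
\<open>w\<close>, whose length is fixed by \<open>trace_cross\<close>. The polarised equation in the direction of \<open>w\<close> then
makes the angle between \<open>F x\<close> and \<open>F w\<close> too large for two points at the same height \<open>|a|/\<surd>2\<close>
unless \<open>n \<le> 2\<close>.
\<close>

lemma constant_height_dim_le_2:
  fixes B :: "'a::euclidean_space \<Rightarrow> 'a \<Rightarrow> real ^ 3"
  assumes "quadratic_sphere_map B \<phi>"
    and h: "\<And>x y. quadratic_sphere_map.height B x y = real DIM('a) * (x \<bullet> y)"
  shows "DIM('a) \<le> 2"
proof -
  interpret quadratic_sphere_map B \<phi> by fact
  define n a where "n = real DIM('a)" and "a = ambient_laplacian"
  have ha: "a \<bullet> B x y = n * (x \<bullet> y)" for x y
    using h unfolding height_def n_def a_def .
  have n0: "n > 0" by (simp add: n_def)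
  have aa: "a \<bullet> a = 2 * n\<^sup>2"
  proof -
    have "a \<bullet> a = 2 * (\<Sum>e\<in>Basis. a \<bullet> B e e)"
      unfolding inner_sum_right[symmetric] by (subst (2) a_def) (simp add: ambient_laplacian_def)
    then show ?thesis by (simp add: ha n_def power2_eq_square)
  qed
  obtain x :: 'a where x: "norm x = 1" using vector_choose_size[of 1] by auto
  then have xx: "x \<bullet> x = 1" by (simp add: dot_square_norm)
  define p c where "p = B x x" and "c = cross3 p a"
  have pp: "p \<bullet> p = 1" using inner_diag[of x] xx by (simp add: p_def)
  have pa: "a \<bullet> p = n" by (simp add: p_def ha xx)
  have cc: "c \<bullet> c = n\<^sup>2"
    using norm_cross_dot[of p a] pp pa aa
    by (simp add: c_def power_mult_distrib power2_norm_eq_inner inner_commute)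
  \<comment> \<open>\<open>g y\<close> is the coordinate of \<open>B x y\<close> along the tangent line of the circle at \<open>p\<close>, since
    \<open>c\<close> spans this line and has length \<open>n\<close>; \<open>w\<close> represents the linear form \<open>g\<close>.\<close>
  define g where "g y = (c \<bullet> B x y) / n" for y
  define w where "w = (\<Sum>e\<in>Basis. g e *\<^sub>R e)"
  have gw: "g y = w \<bullet> y" for y
  proof -
    have "w \<bullet> y = (\<Sum>e\<in>Basis. (c \<bullet> B x ((y \<bullet> e) *\<^sub>R e)) / n)"
      unfolding w_def inner_sum_left
      by (simp add: g_def scaleR_right inner_commute[of y] mult.commute)
    also have "\<dots> = g y"
      unfolding g_def sum_divide_distrib[symmetric] inner_sum_right[symmetric] sum_right[symmetric]
        euclidean_representation ..
    finally show ?thesis ..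
  qed
  have wx: "w \<bullet> x = 0"
    unfolding gw[symmetric] g_def p_def[symmetric] c_def by (simp add: dot_cross_self)
  have B2: "B x y \<bullet> B x y = (w \<bullet> y)\<^sup>2" if "y \<bullet> x = 0" for y
  proof -
    have "B x y \<bullet> p = 0" "B x y \<bullet> a = 0"
      using that inner_diag_cross[of x y] ha[of x y] by (simp_all add: p_def inner_commute)
    from orthogonal_line_cross3[OF this]
    have "n\<^sup>2 *\<^sub>R B x y = (n * (w \<bullet> y)) *\<^sub>R c"
      unfolding c_def[symmetric] cc using n0 by (simp add: gw[symmetric] g_def)
    then have "(n\<^sup>2 *\<^sub>R B x y) \<bullet> (n\<^sup>2 *\<^sub>R B x y) = (n * (w \<bullet> y))\<^sup>2 * n\<^sup>2"
      by (simp add: cc power2_eq_square)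
    then show ?thesis using n0 by (simp add: power2_eq_square)
  qed
  have decomp: "B x e \<bullet> B x e = (x \<bullet> e)\<^sup>2 + (w \<bullet> e)\<^sup>2" for e
  proof -
    define y where "y = e - (e \<bullet> x) *\<^sub>R x"
    have y: "y \<bullet> x = 0" by (simp add: y_def inner_diff_left xx)
    have "B x e = (e \<bullet> x) *\<^sub>R p + B x y" by (simp add: y_def p_def diff_right scaleR_right)
    moreover have "p \<bullet> B x y = 0" using y inner_diag_cross[of x y] by (simp add: p_def inner_commute)
    moreover have "w \<bullet> y = w \<bullet> e" by (simp add: y_def inner_diff_right wx)
    ultimately show ?thesis using B2[OF y] pp
      by (simp add: inner_left_distrib inner_right_distrib inner_commute power2_eq_square)
  qed
  have "(\<Sum>e\<in>Basis. B x e \<bullet> B x e) = 1 + w \<bullet> w"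
    unfolding decomp sum.distrib power2_eq_square euclidean_inner[symmetric] xx by simp
  then have ww: "w \<bullet> w = n / 4"
    using trace_cross[of x] h[of x x] xx by (simp add: n_def)
  define q where "q = B w w"
  have "p \<bullet> q + 2 * (w \<bullet> w)\<^sup>2 = w \<bullet> w"
    using inner_diag_diag[of x w] B2[OF wx] xx wx by (simp add: p_def q_def inner_commute)
  moreover have qq: "q \<bullet> q = (w \<bullet> w)\<^sup>2" by (simp add: q_def inner_diag)
  moreover have qa: "a \<bullet> q = n * (w \<bullet> w)" by (simp add: q_def ha)
  \<comment> \<open>The vectors \<open>p\<close> and \<open>q / |w|\<^sup>2\<close> are unit vectors making angles of 45 degrees with \<open>a\<close>, so the
    angle between them is at most 90 degrees.\<close>
  moreover have "p \<bullet> q \<ge> 0"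
  proof -
    let ?v = "(w \<bullet> w) *\<^sub>R p + q"
    have av: "a \<bullet> ?v = 2 * n * (w \<bullet> w)" by (simp add: inner_right_distrib pa qa)
    have vv: "?v \<bullet> ?v = 2 * (w \<bullet> w)\<^sup>2 + 2 * (w \<bullet> w) * (p \<bullet> q)"
      by (simp add: inner_left_distrib inner_right_distrib pp qq inner_commute power2_eq_square)
    have "n\<^sup>2 * (w \<bullet> w) * (p \<bullet> q) \<ge> 0"
      using Cauchy_Schwarz_ineq[of a ?v] unfolding av vv aa
      by (simp add: power2_eq_square algebra_simps)
    moreover have "n\<^sup>2 * (w \<bullet> w) > 0" using n0 by (simp add: ww)
    ultimately show ?thesis by (simp add: zero_le_mult_iff)
  qed
  ultimately have "2 * (w \<bullet> w) * (w \<bullet> w) \<le> 1 * (w \<bullet> w)" by (simp add: power2_eq_square)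
  then have "2 * (w \<bullet> w) \<le> 1"
    using n0 ww mult_right_le_imp_le[of "2 * (w \<bullet> w)" "w \<bullet> w" 1] by simp
  then show ?thesis by (simp add: ww n_def)
qed

section \<open>Nonexistence of proper biharmonic quadratic forms\<close>

text \<open>
Symmetrising the coefficients gives the polar form; \<open>|F x| = |x|\<^sup>2\<close> holds for all \<open>x\<close> by homogeneity.
\<close>

lemma quadratic_form_bilinear:
  fixes \<phi> :: "real ^ 'k \<Rightarrow> real ^ 'l"
  assumes "sphere_quadratic_form \<phi>"
  obtains B where "quadratic_sphere_map B \<phi>"
proof -
  obtain F where F: "\<And>i. homogeneous_quadratic (\<lambda>x. F x $ i)"
    "F ` sphere 0 1 \<subseteq> sphere 0 1" "\<And>x. x \<in> sphere 0 1 \<Longrightarrow> \<phi> x = F x"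
    using assms unfolding sphere_quadratic_form_def by blast
  obtain c :: "'l \<Rightarrow> 'k \<Rightarrow> 'k \<Rightarrow> real"
    where c: "\<And>i x. F x $ i = (\<Sum>j\<in>UNIV. \<Sum>k\<in>UNIV. c i j k * x $ j * x $ k)"
  proof -
    have "\<forall>i. \<exists>a. \<forall>x. F x $ i = (\<Sum>j\<in>UNIV. \<Sum>k\<in>UNIV. a j k * x $ j * x $ k)"
      using F(1) unfolding homogeneous_quadratic_def by blast
    from choice[OF this] show thesis using that by blast
  qed
  define b where "b x y i = (\<Sum>j\<in>UNIV. \<Sum>k\<in>UNIV. c i j k * x $ j * y $ k)"
    for x y :: "real ^ 'k" and i
  define B :: "real ^ 'k \<Rightarrow> real ^ 'k \<Rightarrow> real ^ 'l"
    where "B x y = (\<chi> i. (b x y i + b y x i) / 2)" for x y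
  have b: "b (x + x') y i = b x y i + b x' y i" "b x (y + y') i = b x y i + b x y' i"
    "b (r *\<^sub>R x) y i = r * b x y i" "b x (r *\<^sub>R y) i = r * b x y i" for x x' y y' r i
    by (simp_all add: b_def algebra_simps sum.distrib sum_distrib_left)
  have "bilinear B"
    unfolding bilinear_def
    by (auto intro!: linearI simp: B_def b vec_eq_iff field_simps)
  then have bb: "bounded_bilinear B" by (simp add: bilinear_conv_bounded_bilinear)
  have diag: "B x x = F x" for x by (simp add: B_def b_def c vec_eq_iff)
  interpret B: bounded_bilinear B by fact
  have "quadratic_sphere_map B \<phi>"
  proof
    show "B x y = B y x" for x y by (simp add: B_def add.commute)
    show "norm (B x x) = (norm x)\<^sup>2" for x
    proof (cases "x = 0")
      case False
      then have "x /\<^sub>R norm x \<in> sphere 0 1" by simp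
      then have "norm (B (x /\<^sub>R norm x) (x /\<^sub>R norm x)) = 1"
        using F(2) unfolding diag by fastforce
      then have "norm (B x x) / (norm x * norm x) = 1"
        unfolding B.scaleR_left B.scaleR_right by (simp add: divide_inverse mult.commute)
      then show ?thesis
        using False by (simp add: power2_eq_square)
    qed (simp add: B.zero_left)
    show "\<phi> x = B x x" if "norm x = 1" for x
      using F(3) that by (simp add: diag)
  qed
  then show thesis by (rule that)
qed

theorem theorem4p10:
  fixes m :: nat
  assumes "m \<ge> 2" and "CARD('k::finite) = m + 1"
  shows "\<not> (\<exists>\<phi> :: real ^ 'k \<Rightarrow> real ^ 3.
            sphere_quadratic_form \<phi> \<and> proper_biharmonic_sphere_map \<phi>)"
proof
  assume "\<exists>\<phi> :: real ^ 'k \<Rightarrow> real ^ 3. sphere_quadratic_form \<phi> \<and> proper_biharmonic_sphere_map \<phi>"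
  then obtain \<phi> :: "real ^ 'k \<Rightarrow> real ^ 3" where q: "sphere_quadratic_form \<phi>"
    and bi: "\<And>x. norm x = 1 \<Longrightarrow> bitension_field \<phi> x = 0" and nh: "\<not> harmonic_sphere_map \<phi>"
    unfolding proper_biharmonic_sphere_map_def biharmonic_sphere_map_def by auto
  obtain B where B: "quadratic_sphere_map B \<phi>" by (rule quadratic_form_bilinear[OF q])
  interpret quadratic_sphere_map B \<phi> by (rule B)
  obtain l where l: "\<And>x y. height x y = l * (x \<bullet> y)"
    "(real DIM(real ^ 'k) - l) * (ambient_laplacian \<bullet> ambient_laplacian - l\<^sup>2) = 0"
    by (rule biharmonic_height_constant, erule bi) (rule that)
  have "ambient_laplacian \<bullet> ambient_laplacian \<noteq> l\<^sup>2"
    using harmonic_if_height_extremal[OF l(1)] nh by metis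
  then have "l = real DIM(real ^ 'k)" using l(2) by simp
  then have "DIM(real ^ 'k) \<le> 2"
    by (intro constant_height_dim_le_2[OF B]) (simp only: l(1))
  then show False using assms by simp
qed

end
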